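(* (Fundamental theorem of algebra for $\mathbb{A}_n$.) Let $n\geq 1$. Every generalized polynomial on $\mathbb{A}_n$ has at least one root in $\mathbb{A}_n$. That is: let $k>0$ be an integer and let $p:\mathbb{A}_n\to\mathbb{A}_n$ be a continuous function such that $$p(x)=x^k\,(e_0+g(x))\qquad\text{for all }x\neq 0,$$ where $g:\mathbb{A}_n\setminus\{0\}\to\mathbb{A}_n$ is a nonconstant continuous function with $\|g(x)\|\to 0$ as $\|x\|\to\infty$. Then there is $\alpha\in\mathbb{A}_n$ with $p(\alpha)=0$.
   Context: The Cayley-Dickson algebras $\mathbb{A}_n=\mathbb{R}^{2^n}$ are defined by $\mathbb{A}_0=\mathbb{R}$ with $\overline{x}=x$, and $\mathbb{A}_{n+1}=\mathbb{A}_n\times\mathbb{A}_n$ with product $(a,b)(x,y)=(ax-\overline{y}b,\;ya+b\overline{x})$ and conjugation $\overline{(x_1,x_2)}=(\overline{x_1},-x_2)$. The first canonical basis vector $e_0$ is the unit; $\|\cdot\|$ is the Euclidean norm of $\mathbb{R}^{2^n}$. Powers: $x^0=e_0$, $x^{m+1}=x^m x$ (the algebras are power-associative). *)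

theory Defs
  imports "HOL-Analysis.Analysis" "HOL-Library.Going_To_Filter"
begin

text \<open>
  The algebra \<open>A\<^sub>n = \<real>\<^bsup>2^n\<^esup>\<close> is carried by the library's \<^term>\<open>Euclidean_space (2 ^ n)\<close>: its points are
  the functions \<^typ>\<open>nat \<Rightarrow> real\<close> vanishing at all indices \<open>i \<ge> 2 ^ n\<close>, with the usual topology of
  \<open>\<real>\<^bsup>2^n\<^esup>\<close>, so that \<open>n\<close> can be a variable.
\<close>

abbreviation cd_space :: "nat \<Rightarrow> (nat \<Rightarrow> real) topology" where
  "cd_space n \<equiv> Euclidean_space (2 ^ n)"

definition cd_norm :: "nat \<Rightarrow> (nat \<Rightarrow> real) \<Rightarrow> real" where
  "cd_norm n x = L2_set x {..<2 ^ n}"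

text \<open>
  The identification \<open>A\<^sub>n\<^sub>+\<^sub>1 = A\<^sub>n \<times> A\<^sub>n\<close> is concatenation of coordinates: \<open>cd_pair n a b\<close> is the
  pair \<open>(a, b)\<close>, and \<open>cd_fst n x\<close>, \<open>cd_snd n x\<close> are the two components in \<open>A\<^sub>n\<close> of \<open>x\<close> in \<open>A\<^sub>n\<^sub>+\<^sub>1\<close>.
\<close>

definition cd_pair :: "nat \<Rightarrow> (nat \<Rightarrow> real) \<Rightarrow> (nat \<Rightarrow> real) \<Rightarrow> nat \<Rightarrow> real" where
  "cd_pair n a b =
     (\<lambda>i. if i < 2 ^ n then a i else if i < 2 ^ Suc n then b (i - 2 ^ n) else 0)"

definition cd_fst :: "nat \<Rightarrow> (nat \<Rightarrow> real) \<Rightarrow> nat \<Rightarrow> real" where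
  "cd_fst n x = (\<lambda>i. if i < 2 ^ n then x i else 0)"

definition cd_snd :: "nat \<Rightarrow> (nat \<Rightarrow> real) \<Rightarrow> nat \<Rightarrow> real" where
  "cd_snd n x = (\<lambda>i. if i < 2 ^ n then x (i + 2 ^ n) else 0)"

primrec cd_conj :: "nat \<Rightarrow> (nat \<Rightarrow> real) \<Rightarrow> nat \<Rightarrow> real" where
  "cd_conj 0 x = x"
| "cd_conj (Suc n) x = cd_pair n (cd_conj n (cd_fst n x)) (\<lambda>i. - cd_snd n x i)"

primrec cd_mult :: "nat \<Rightarrow> (nat \<Rightarrow> real) \<Rightarrow> (nat \<Rightarrow> real) \<Rightarrow> nat \<Rightarrow> real" where
  "cd_mult 0 u v = (\<lambda>i. if i = 0 then u 0 * v 0 else 0)"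
| "cd_mult (Suc n) u v =
     (let a = cd_fst n u; b = cd_snd n u; x = cd_fst n v; y = cd_snd n v
      in cd_pair n
           (\<lambda>i. cd_mult n a x i - cd_mult n (cd_conj n y) b i)
           (\<lambda>i. cd_mult n y a i + cd_mult n b (cd_conj n x) i))"

definition cd_unit :: "nat \<Rightarrow> real" where
  "cd_unit = (\<lambda>i. if i = 0 then 1 else 0)"

primrec cd_power :: "nat \<Rightarrow> (nat \<Rightarrow> real) \<Rightarrow> nat \<Rightarrow> nat \<Rightarrow> real" where
  "cd_power n x 0 = cd_unit"
| "cd_power n x (Suc m) = cd_mult n (cd_power n x m) x"

end

(*
  If p had no root, then x |-> p (R x) / |p (R x)| would be a null-homotopic self-map of the unit
  sphere, since p extends it over the contractible space A_n. For large R it is homotopic to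
  x |-> x^k along straight segments, because x^k g (R x) is then too small to cancel x^k. So it
  remains to see that x^k has non-zero degree on the sphere.

  On the unit sphere x x = 2 x_0 x - e_0, so the powers satisfy the Chebyshev recursion
  x^(m+2) = 2 x_0 x^(m+1) - x^m, which involves neither the product nor the dimension. For odd k
  the map is odd and preserves all coordinate subspheres, so its degree is odd by Borsuk's theorem.
  Squaring has degree 2, and x^(2m) = (x^2)^m handles even k.
*)

theory Submission
  imports Defs "HOL-Homology.Homology"
begin

subsection \<open>Linear homotopies into spheres\<close>

text \<open>Radial projection onto the unit sphere of R^(q+1). Division by zero leaves the origin at
  the origin, off the sphere, hence the nonvanishing hypotheses below.\<close>

definition nsphere_normalize :: "nat \<Rightarrow> (nat \<Rightarrow> real) \<Rightarrow> nat \<Rightarrow> real" where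
  "nsphere_normalize q x = (\<lambda>i. x i / sqrt (\<Sum>j\<le>q. (x j)\<^sup>2))"

lemma in_topspace_nsphere_iff:
  "x \<in> topspace (nsphere q) \<longleftrightarrow> (\<Sum>i\<le>q. (x i)\<^sup>2) = 1 \<and> (\<forall>i>q. x i = 0)"
  by (auto simp: nsphere)

lemma nsphere_normalize_id: "x \<in> topspace (nsphere q) \<Longrightarrow> nsphere_normalize q x = x"
  by (simp add: in_topspace_nsphere_iff nsphere_normalize_def)

lemma continuous_map_Euclidean_space_componentwise:
  "continuous_map X (Euclidean_space n) f \<longleftrightarrow>
     (\<forall>i. continuous_map X euclideanreal (\<lambda>x. f x i)) \<and> (\<forall>x\<in>topspace X. \<forall>i\<ge>n. f x i = 0)"
  by (auto simp: Euclidean_space_def continuous_map_in_subtopology continuous_map_componentwise_UNIV)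

lemma continuous_map_nsphere_componentwise:
  "continuous_map X (nsphere q) f \<longleftrightarrow>
     (\<forall>i. continuous_map X euclideanreal (\<lambda>x. f x i)) \<and> (\<forall>x\<in>topspace X. f x \<in> topspace (nsphere q))"
  by (auto simp: nsphere continuous_map_in_subtopology continuous_map_componentwise_UNIV)

lemma sum_squares_pos:
  assumes "x \<in> topspace (Euclidean_space (Suc q))" "x \<noteq> (\<lambda>_. 0)"
  shows "(\<Sum>j\<le>q. (x j)\<^sup>2) > 0"
proof -
  obtain i where i: "x i \<noteq> 0" using assms(2) by fastforce
  then have "i \<le> q"
    using assms(1) by (fastforce simp: topspace_Euclidean_space not_less_eq_eq)
  have "0 < (x i)\<^sup>2" using i by simp
  also have "\<dots> \<le> (\<Sum>j\<le>q. (x j)\<^sup>2)"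
    using \<open>i \<le> q\<close> by (intro member_le_sum) auto
  finally show ?thesis .
qed

lemma continuous_map_nsphere_normalize:
  assumes f: "continuous_map X (Euclidean_space (Suc q)) f"
    and nz: "\<And>x. x \<in> topspace X \<Longrightarrow> f x \<noteq> (\<lambda>_. 0)"
  shows "continuous_map X (nsphere q) (\<lambda>x. nsphere_normalize q (f x))"
  unfolding continuous_map_nsphere_componentwise
proof (intro conjI allI ballI)
  have pos: "(\<Sum>j\<le>q. (f x j)\<^sup>2) > 0" if "x \<in> topspace X" for x
    using that f nz by (intro sum_squares_pos) (auto simp: continuous_map_def)
  have cont: "continuous_map X euclideanreal (\<lambda>x. f x i)" for i
    using f by (simp add: continuous_map_Euclidean_space_componentwise)
  show "continuous_map X euclideanreal (\<lambda>x. nsphere_normalize q (f x) i)" for i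
    unfolding nsphere_normalize_def
  proof (rule continuous_map_real_divide [OF cont])
    show "continuous_map X euclideanreal (\<lambda>x. sqrt (\<Sum>j\<le>q. (f x j)\<^sup>2))"
      by (intro continuous_map_sqrt continuous_map_sum continuous_map_real_pow cont) auto
    show "sqrt (\<Sum>j\<le>q. (f x j)\<^sup>2) \<noteq> 0" if "x \<in> topspace X" for x
      using pos [OF that] by simp
  qed
  show "nsphere_normalize q (f x) \<in> topspace (nsphere q)" if "x \<in> topspace X" for x
  proof -
    have "(\<Sum>i\<le>q. (nsphere_normalize q (f x) i)\<^sup>2) = (\<Sum>i\<le>q. (f x i)\<^sup>2 / (\<Sum>j\<le>q. (f x j)\<^sup>2))"
      using less_imp_le [OF pos [OF that]] by (simp add: nsphere_normalize_def power_divide)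
    also have "\<dots> = 1"
      using pos [OF that] by (subst sum_divide_distrib [symmetric]) simp
    finally have "(\<Sum>i\<le>q. (nsphere_normalize q (f x) i)\<^sup>2) = 1" .
    moreover have "nsphere_normalize q (f x) i = 0" if "i > q" for i
      using f \<open>x \<in> topspace X\<close> that
      unfolding nsphere_normalize_def continuous_map_Euclidean_space_componentwise
      by (simp add: Suc_le_eq)
    ultimately show ?thesis
      by (simp add: in_topspace_nsphere_iff)
  qed
qed

text \<open>Segments that miss the origin project radially to a homotopy inside the sphere;
  \<open>nz\<close> is the geometric input to be checked in each use.\<close>

lemma homotopic_with_nsphere_normalize:
  assumes f: "continuous_map X (Euclidean_space (Suc q)) f"
    and g: "continuous_map X (Euclidean_space (Suc q)) g"
    and nz: "\<And>x s. \<lbrakk>x \<in> topspace X; 0 \<le> s; s \<le> 1\<rbrakk> \<Longrightarrow> (\<lambda>i. (1 - s) * f x i + s * g x i) \<noteq> (\<lambda>_. 0)"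
  shows "homotopic_with (\<lambda>_. True) X (nsphere q)
           (\<lambda>x. nsphere_normalize q (f x)) (\<lambda>x. nsphere_normalize q (g x))"
proof -
  let ?P = "prod_topology (top_of_set {0..1::real}) X"
  let ?h = "\<lambda>z i. (1 - fst z) * f (snd z) i + fst z * g (snd z) i"
  have fs: "continuous_map ?P euclideanreal fst"
    using continuous_map_fst [of "top_of_set {0..1::real}" X] by (rule continuous_map_into_fulltopology)
  have snd_comp: "continuous_map ?P Y (\<lambda>z. k (snd z))" if "continuous_map X Y k" for k and Y :: "real topology"
    using continuous_map_compose [OF continuous_map_snd that, of "top_of_set {0..1::real}"]
    unfolding o_def .
  have f': "\<And>i. continuous_map X euclideanreal (\<lambda>x. f x i)" "\<And>x i. x \<in> topspace X \<Longrightarrow> i \<ge> Suc q \<Longrightarrow> f x i = 0"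
    and g': "\<And>i. continuous_map X euclideanreal (\<lambda>x. g x i)" "\<And>x i. x \<in> topspace X \<Longrightarrow> i \<ge> Suc q \<Longrightarrow> g x i = 0"
    using f g unfolding continuous_map_Euclidean_space_componentwise by blast+
  have "continuous_map ?P (Euclidean_space (Suc q)) ?h"
    unfolding continuous_map_Euclidean_space_componentwise
  proof (intro conjI allI ballI impI)
    show "continuous_map ?P euclideanreal (\<lambda>z. ?h z i)" for i
      by (intro continuous_map_add continuous_map_real_mult continuous_map_diff fs
            snd_comp [OF f'(1)] snd_comp [OF g'(1)] continuous_map_canonical_const)
    show "?h z i = 0" if "z \<in> topspace ?P" "Suc q \<le> i" for z i
      using that f'(2) g'(2) by auto
  qed
  then have "continuous_map ?P (nsphere q) (\<lambda>z. nsphere_normalize q (?h z))"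
  proof (rule continuous_map_nsphere_normalize)
    show "?h z \<noteq> (\<lambda>_. 0)" if "z \<in> topspace ?P" for z
      using that by (intro nz) (simp_all add: mem_Times_iff)
  qed
  then show ?thesis
    unfolding homotopic_with_def
    by (intro exI [of _ "\<lambda>z. nsphere_normalize q (?h z)"] conjI) simp_all
qed

subsection \<open>Additivity of the degree\<close>

text \<open>
  \<open>u\<close> and \<open>l\<close> are \<open>f\<close> with one hemisphere collapsed to the value \<open>c\<close> of \<open>f\<close> on the equator \<open>E\<close>. The
  classes of \<open>H\<^sub>q(S, E)\<close> are sums of classes carried by the two hemispheres, and \<open>H\<^sub>q(S)\<close> embeds in
  \<open>H\<^sub>q(S, {c})\<close>, where the contributions of the collapsed hemispheres vanish.
\<close>

proposition Brouwer_degree2_hemisphere_sum: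
  assumes "q > 0" and f: "continuous_map (nsphere q) (nsphere q) f"
    and u: "continuous_map (nsphere q) (nsphere q) u"
    and l: "continuous_map (nsphere q) (nsphere q) l"
    and fu: "\<And>x. \<lbrakk>x \<in> topspace (nsphere q); x 0 \<ge> 0\<rbrakk> \<Longrightarrow> f x = u x \<and> l x = c"
    and fl: "\<And>x. \<lbrakk>x \<in> topspace (nsphere q); x 0 \<le> 0\<rbrakk> \<Longrightarrow> f x = l x \<and> u x = c"
  shows "Brouwer_degree2 q f = Brouwer_degree2 q u + Brouwer_degree2 q l"
proof -
  let ?S = "nsphere q"
  let ?E = "{x::nat\<Rightarrow>real. x 0 = 0}"
  let ?U = "{x::nat\<Rightarrow>real. x 0 \<ge> 0}"
  let ?L = "{x::nat\<Rightarrow>real. x 0 \<le> 0}"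
  let ?US = "subtopology ?S ?U"
  let ?LS = "subtopology ?S ?L"
  let ?H = "relative_homology_group q ?S ?E"
  let ?K = "relative_homology_group q ?S {c}"
  let ?G = "homology_group q ?S"
  \<comment> \<open>Since \<open>q > 0\<close>, the equator is nonempty, and this puts
    \<open>c\<close> on the sphere.\<close>
  have "\<exists>x\<in>topspace ?S. x 0 = 0"
    by (rule bexI [of _ "\<lambda>i. if i = q then 1 else 0"])
       (use \<open>q > 0\<close> in \<open>simp_all add: in_topspace_nsphere_iff if_distrib [of "\<lambda>x. x ^ 2"] cong: if_cong\<close>)
  then obtain e where e: "e \<in> topspace ?S" "e 0 = 0" by blast
  then have c: "c \<in> topspace ?S"
    using fl [of e] u by (auto simp: continuous_map_def Pi_iff)
  \<comment> \<open>\<open>?E\<close> is a whole hyperplane, while maps are controlled only on the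
    sphere. Intersecting with the space makes the subset conditions of
    \<open>hom_induced_compose'\<close> provable and leaves the induced map unchanged.\<close>
  have restrict: "hom_induced q Y (topspace Y \<inter> T) ?S {c} = hom_induced q Y T ?S {c}"
    for Y :: "(nat \<Rightarrow> real) topology" and T
  proof -
    have "topspace ?S \<inter> {c} = {c}" using c by auto
    then show ?thesis by (metis hom_induced_restrict)
  qed
  have restrict_empty: "hom_induced q ?S {} ?S (topspace ?S \<inter> ?E) = hom_induced q ?S {} ?S ?E"
    using hom_induced_restrict [of q ?S "{}" ?S ?E] by (simp only: Int_empty_right)
  have E: "f x = c" "u x = c" "l x = c" if "x \<in> topspace ?S" "x 0 = 0" for x
    using fu [of x] fl [of x] that by auto
  interpret H: comm_group ?H by simp
  interpret K: comm_group ?K by simp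
  interpret G: comm_group ?G by simp
  have hom: "group_hom ?H ?K (hom_induced q ?S ?E ?S {c} w)" for w
    by (simp add: group_hom_axioms_def group_hom_def hom_induced_hom)
  \<comment> \<open>A map constant at \<open>c\<close> factors through a point relative to itself,
    whose homology is trivial.\<close>
  have const: "hom_induced q Y T ?S {c} w x = \<one>\<^bsub>?K\<^esub>"
    if "\<And>x. x \<in> topspace Y \<Longrightarrow> w x = c" for Y :: "(nat \<Rightarrow> real) topology" and T w x
  proof -
    let ?pt = "subtopology ?S {c}"
    have "hom_induced q Y T ?S {c} w x = hom_induced q Y T ?S {c} (id \<circ> (\<lambda>_. c)) x"
      using hom_induced_eq [of Y w "\<lambda>_. c"] that by simp
    also have "\<dots> = hom_induced q ?pt {c} ?S {c} id (hom_induced q Y T ?pt {c} (\<lambda>_. c) x)"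
      by (rule hom_induced_compose' [symmetric]) (use c in auto)
    also have "hom_induced q Y T ?pt {c} (\<lambda>_. c) x = \<one>\<^bsub>relative_homology_group q ?pt {c}\<^esub>"
      using trivial_relative_homology_group_topspace [of q ?pt] c
        hom_induced_carrier [of q Y T ?pt "{c}" "\<lambda>_. c" x]
      by (simp add: trivial_group_def)
    also have "hom_induced q ?pt {c} ?S {c} id \<one>\<^bsub>relative_homology_group q ?pt {c}\<^esub> = \<one>\<^bsub>?K\<^esub>"
      using hom_induced_hom hom_one group_relative_homology_group by blast
    finally show ?thesis .
  qed
  let ?iU = "hom_induced q ?US ?E ?S ?E id" and ?iL = "hom_induced q ?LS ?E ?S ?E id"
  \<comment> \<open>The image of \<open>y\<close> in H_q(S, L) comes from the upper hemisphere by
    excision. Removing that part leaves a class that dies in H_q(S, L), so by exactness for the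
    triple E, L, S it comes from the lower hemisphere.\<close>
  have gen: "\<exists>a b. y = ?iU a \<otimes>\<^bsub>?H\<^esub> ?iL b" if y: "y \<in> carrier ?H" for y
  proof -
    let ?j = "hom_induced q ?S ?E ?S ?L id"
    let ?M = "relative_homology_group q ?S ?L"
    interpret j: group_hom ?H ?M ?j
      by (simp add: group_hom_axioms_def group_hom_def hom_induced_hom)
    obtain a where a: "?j y = hom_induced q ?US ?E ?S ?L id a"
      using iso_relative_homology_group_upper_hemisphere [of q q 0] hom_induced_carrier
      unfolding iso_iff by (metis (no_types, lifting) imageE)
    have "?j (?iU a) = hom_induced q ?US ?E ?S ?L id a"
      by (subst hom_induced_compose') auto
    moreover have ca: "?iU a \<in> carrier ?H"
      by (rule hom_induced_carrier)
    ultimately have "?j (inv\<^bsub>?H\<^esub> (?iU a) \<otimes>\<^bsub>?H\<^esub> y) = \<one>\<^bsub>?M\<^esub>"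
      using a y j.H.l_inv [OF j.hom_closed [OF y]] by (simp del: one_relative_homology_group)
    then have "inv\<^bsub>?H\<^esub> (?iU a) \<otimes>\<^bsub>?H\<^esub> y \<in> kernel ?H ?M ?j"
      using y ca by (simp add: kernel_def del: one_relative_homology_group)
    also have "kernel ?H ?M ?j = ?iL ` carrier (relative_homology_group q ?LS ?E)"
    proof -
      have "?E \<subseteq> ?L" by auto
      then show ?thesis
        using homology_exactness_triple_3 [of ?E ?L q ?S] by simp
    qed
    finally obtain b where "inv\<^bsub>?H\<^esub> (?iU a) \<otimes>\<^bsub>?H\<^esub> y = ?iL b"
      by blast
    then have "y = ?iU a \<otimes>\<^bsub>?H\<^esub> ?iL b"
      using y ca by (metis H.inv_closed H.inv_solve_left hom_induced_carrier)
    then show ?thesis by blast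
  qed
  have split: "hom_induced q ?S ?E ?S {c} f y
      = hom_induced q ?S ?E ?S {c} u y \<otimes>\<^bsub>?K\<^esub> hom_induced q ?S ?E ?S {c} l y"
    if y: "y \<in> carrier ?H" for y
  proof -
    obtain a b where ab: "y = ?iU a \<otimes>\<^bsub>?H\<^esub> ?iL b"
      using gen [OF y] by blast
    have sum: "hom_induced q ?S ?E ?S {c} w y
        = hom_induced q ?US ?E ?S {c} w a \<otimes>\<^bsub>?K\<^esub> hom_induced q ?LS ?E ?S {c} w b"
      if w: "continuous_map ?S ?S w" and wE: "\<And>x. x \<in> topspace ?S \<Longrightarrow> x 0 = 0 \<Longrightarrow> w x = c" for w
    proof -
      interpret w: group_hom ?H ?K "hom_induced q ?S ?E ?S {c} w" by (rule hom)
      have comp: "hom_induced q ?S ?E ?S {c} w (hom_induced q (subtopology ?S T) ?E ?S ?E id a)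
          = hom_induced q (subtopology ?S T) ?E ?S {c} w a" for T a
      proof -
        have "hom_induced q ?S ?E ?S {c} w (hom_induced q (subtopology ?S T) ?E ?S ?E id a)
          = hom_induced q ?S (topspace ?S \<inter> ?E) ?S {c} w
              (hom_induced q (subtopology ?S T) (topspace (subtopology ?S T) \<inter> ?E) ?S (topspace ?S \<inter> ?E) id a)"
          by (simp only: restrict hom_induced_restrict)
        also have "\<dots> = hom_induced q (subtopology ?S T) (topspace (subtopology ?S T) \<inter> ?E) ?S {c} (w \<circ> id) a"
          by (rule hom_induced_compose') (use w wE in auto)
        also have "\<dots> = hom_induced q (subtopology ?S T) ?E ?S {c} w a"
          by (simp only: restrict comp_id)
        finally show ?thesis .
      qed
      show ?thesis
        unfolding ab by (simp add: hom_induced_carrier comp)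
    qed
    have cU: "hom_induced q ?US ?E ?S {c} w a = \<one>\<^bsub>?K\<^esub>"
      if "\<And>x. x \<in> topspace ?S \<Longrightarrow> x 0 \<ge> 0 \<Longrightarrow> w x = c" for w
      by (rule const) (use that in auto)
    have cL: "hom_induced q ?LS ?E ?S {c} w b = \<one>\<^bsub>?K\<^esub>"
      if "\<And>x. x \<in> topspace ?S \<Longrightarrow> x 0 \<le> 0 \<Longrightarrow> w x = c" for w
      by (rule const) (use that in auto)
    have "hom_induced q ?US ?E ?S {c} f = hom_induced q ?US ?E ?S {c} u"
      by (rule hom_induced_eq) (use fu in auto)
    moreover have "hom_induced q ?LS ?E ?S {c} f = hom_induced q ?LS ?E ?S {c} l"
      by (rule hom_induced_eq) (use fl in auto)
    ultimately show ?thesis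
      using sum [OF f E(1)] sum [OF u E(2)] sum [OF l E(3)] cU [of l] cL [of u] fu fl
      by (simp add: hom_induced_carrier del: one_relative_homology_group)
  qed
  let ?k = "hom_induced q ?S {} ?S {c} id"
  interpret k: group_hom ?G ?K ?k
    by (simp add: group_hom_axioms_def group_hom_def hom_induced_hom)
  have red: "reduced_homology_group q X = homology_group q X" for X :: "(nat \<Rightarrow> real) topology"
    using \<open>q > 0\<close> by (simp add: un_reduced_homology_group)
  \<comment> \<open>By exactness for the pair (S, {c}), the kernel is the image of H_q of a point,
    which is trivial as \<open>q > 0\<close>.\<close>
  have inj: "inj_on ?k (carrier ?G)"
  proof (rule k.trivial_ker_imp_inj)
    let ?pt = "subtopology ?S {c}"
    let ?i = "hom_induced q ?pt {} ?S {} id"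
    have "kernel ?G ?K ?k = ?i ` carrier (homology_group q ?pt)"
      using homology_exactness_reduced_3 [of q ?S "{c}"] by (simp add: red)
    moreover have "trivial_group (homology_group q ?pt)"
      using homology_dimension_reduced [of ?pt c q] c by (simp add: red)
    then have "carrier (homology_group q ?pt) = {\<one>\<^bsub>homology_group q ?pt\<^esub>}"
      by (simp add: trivial_group_def)
    moreover have "?i \<one>\<^bsub>homology_group q ?pt\<^esub> = \<one>\<^bsub>?G\<^esub>"
      by (rule hom_one [OF hom_induced_hom group_relative_homology_group group_relative_homology_group])
    ultimately show "kernel ?G ?K ?k = {\<one>\<^bsub>?G\<^esub>}"
      by (simp del: one_relative_homology_group)
  qed
  \<comment> \<open>Naturality: after \<open>?k\<close>, the action of \<open>w\<close> on absolute
    classes passes through H_q(S, E), where \<open>split\<close> applies.\<close>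
  have rel: "?k (hom_induced q ?S {} ?S {} w x) = hom_induced q ?S ?E ?S {c} w (hom_induced q ?S {} ?S ?E id x)"
      if w: "continuous_map ?S ?S w" and wE: "\<And>x. x \<in> topspace ?S \<Longrightarrow> x 0 = 0 \<Longrightarrow> w x = c" for w x
  proof -
    have "?k (hom_induced q ?S {} ?S {} w x) = hom_induced q ?S {} ?S {c} (id \<circ> w) x"
      by (rule hom_induced_compose') (use w in auto)
    also have "\<dots> = hom_induced q ?S {} ?S {c} (w \<circ> id) x" by simp
    also have "\<dots> = hom_induced q ?S (topspace ?S \<inter> ?E) ?S {c} w (hom_induced q ?S {} ?S (topspace ?S \<inter> ?E) id x)"
      by (rule hom_induced_compose' [symmetric]) (use w wE in auto)
    also have "\<dots> = hom_induced q ?S ?E ?S {c} w (hom_induced q ?S {} ?S ?E id x)"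
      by (simp only: restrict restrict_empty)
    finally show ?thesis .
  qed
  show ?thesis
  proof (rule Brouwer_degree2_unique [OF f])
    fix x assume "x \<in> carrier (reduced_homology_group q ?S)"
    then have x: "x \<in> carrier ?G" by (simp add: red)
    let ?h = "hom_induced q ?S {} ?S {}"
    have "?k (?h f x) = ?k (?h u x \<otimes>\<^bsub>?G\<^esub> ?h l x)"
      using split [of "hom_induced q ?S {} ?S ?E id x"]
      by (simp add: rel [OF f E(1)] rel [OF u E(2)] rel [OF l E(3)] hom_induced_carrier)
    then have "?h f x = ?h u x \<otimes>\<^bsub>?G\<^esub> ?h l x"
      by (rule inj_onD [OF inj]) (auto simp: hom_induced_carrier)
    also have "\<dots> = x [^]\<^bsub>?G\<^esub> (Brouwer_degree2 q u + Brouwer_degree2 q l)"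
      using Brouwer_degree2 [of x q u] Brouwer_degree2 [of x q l] x red by (simp add: G.int_pow_mult)
    finally show "?h f x = x [^]\<^bsub>reduced_homology_group q ?S\<^esub> (Brouwer_degree2 q u + Brouwer_degree2 q l)"
      by (simp add: red)
  qed
qed

subsection \<open>The degree of the power maps\<close>

lemma cd_unit_in_nsphere: "cd_unit \<in> topspace (nsphere q)"
  using in_topspace_nsphere by (simp add: cd_unit_def)

lemma continuous_map_nsphere_uminus: "continuous_map (nsphere q) (nsphere q) (\<lambda>x i. - x i)"
  by (simp add: continuous_map_nsphere_componentwise continuous_map_nsphere_projection in_topspace_nsphere_iff)

lemma continuous_map_nsphere_imp_Euclidean_space:
  "continuous_map X (nsphere q) f \<Longrightarrow> continuous_map X (Euclidean_space (Suc q)) f"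
  unfolding nsphere_def by (rule continuous_map_into_fulltopology)

lemma homotopic_with_nsphere_linear:
  assumes f: "continuous_map X (nsphere q) f" and g: "continuous_map X (nsphere q) g"
    and nz: "\<And>x s. \<lbrakk>x \<in> topspace X; 0 \<le> s; s \<le> 1\<rbrakk> \<Longrightarrow> (\<lambda>i. (1 - s) * f x i + s * g x i) \<noteq> (\<lambda>_. 0)"
  shows "homotopic_with (\<lambda>_. True) X (nsphere q) f g"
proof (rule homotopic_with_eq)
  show "homotopic_with (\<lambda>_. True) X (nsphere q) (\<lambda>x. nsphere_normalize q (f x)) (\<lambda>x. nsphere_normalize q (g x))"
    using f g nz by (intro homotopic_with_nsphere_normalize continuous_map_nsphere_imp_Euclidean_space)
  show "f x = nsphere_normalize q (f x)" "g x = nsphere_normalize q (g x)" if "x \<in> topspace X" for x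
    using f g that by (simp_all add: nsphere_normalize_id continuous_map_nsphere_componentwise)
qed simp

lemma Brouwer_degree2_uminus_odd:
  assumes "odd q"
  shows "Brouwer_degree2 q (\<lambda>x i. - x i) = 1"
proof -
  \<comment> \<open>a complex structure: both \<open>id\<close> and the antipodal map are homotopic to it\<close>
  let ?J = "\<lambda>x i. if even i then - x (Suc i) else x (i - 1) :: real"
  have J: "continuous_map (nsphere q) (Euclidean_space (Suc q)) ?J"
    unfolding continuous_map_Euclidean_space_componentwise
  proof (intro conjI allI ballI impI)
    show "continuous_map (nsphere q) euclideanreal (\<lambda>x. ?J x i)" for i
      by (cases "even i") (simp_all add: continuous_map_nsphere_projection)
    show "?J x i = 0" if "x \<in> topspace (nsphere q)" "Suc q \<le> i" for x i
    proof (cases "even i")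
      case True
      then show ?thesis using that by (simp add: in_topspace_nsphere_iff)
    next
      case False
      \<comment> \<open>As \<open>q\<close> is odd, the coordinates 0, ..., q split into pairs
        starting at even indices; an odd index past \<open>q\<close> is at least q + 2, so its
        partner is also past \<open>q\<close>.\<close>
      then have "i \<noteq> Suc q" using \<open>odd q\<close> by auto
      then have "i - 1 > q" using that by simp
      then show ?thesis using that False by (simp add: in_topspace_nsphere_iff)
    qed
  qed
  \<comment> \<open>With \<open>c\<close> equal to 1 or -1, each coordinate pair solves a
    homogeneous 2 by 2 system of determinant \<open>?r * ?r + s * s\<close>, which is
    nonzero.\<close>
  have nonzero: "(\<lambda>i. (1 - s) * (c * x i) + s * ?J x i) \<noteq> (\<lambda>_. 0)"
    if x: "x \<in> topspace (nsphere q)" and c: "c * c = 1" for x s c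
  proof
    assume *: "(\<lambda>i. (1 - s) * (c * x i) + s * ?J x i) = (\<lambda>_. 0)"
    have pair: "x i = 0 \<and> x (Suc i) = 0" if "even i" for i
    proof -
      let ?r = "(1 - s) * c"
      have 1: "?r * x i = s * x (Suc i)" and 2: "?r * x (Suc i) = - s * x i"
        using fun_cong [OF *, of i] fun_cong [OF *, of "Suc i"] that by (auto simp: algebra_simps)
      have "(?r * ?r + s * s) * x i = ?r * (?r * x i) - s * (- s * x i)"
        by (simp add: distrib_right)
      also have "\<dots> = 0"
        unfolding 1 2 [symmetric] by (simp add: mult.left_commute)
      finally have "(?r * ?r + s * s) * x i = 0" .
      moreover have "(?r * ?r + s * s) * x (Suc i) = ?r * (?r * x (Suc i)) + s * (s * x (Suc i))"
        by (simp add: distrib_right)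
      then have "(?r * ?r + s * s) * x (Suc i) = 0"
        unfolding 2 1 [symmetric] by (simp add: mult.left_commute)
      moreover have "?r * ?r + s * s \<noteq> 0"
      proof
        assume "?r * ?r + s * s = 0"
        then have "?r = 0" "s = 0"
          unfolding sum_squares_eq_zero_iff by blast+
        with c show False by simp
      qed
      ultimately show ?thesis
        unfolding mult_eq_0_iff [of "?r * ?r + s * s"] by blast
    qed
    have "x i = 0" for i
      using pair [of i] pair [of "i - 1"] by (cases "even i") (auto simp: odd_pos)
    with x show False by (simp add: in_topspace_nsphere_iff)
  qed
  have homotopy: "homotopic_with (\<lambda>_. True) (nsphere q) (nsphere q)
      (\<lambda>x. nsphere_normalize q (\<lambda>i. c * x i)) (\<lambda>x. nsphere_normalize q (?J x))" if "c * c = 1" for c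
  proof (rule homotopic_with_nsphere_normalize [OF _ J])
    show "continuous_map (nsphere q) (Euclidean_space (Suc q)) (\<lambda>x i. c * x i)"
      by (simp add: continuous_map_Euclidean_space_componentwise continuous_map_nsphere_projection
          continuous_map_real_mult_left in_topspace_nsphere_iff)
  qed (use nonzero that in blast)
  have "Brouwer_degree2 q (\<lambda>x i. - x i) = Brouwer_degree2 q (\<lambda>x. nsphere_normalize q (\<lambda>i. - 1 * x i))"
    by (rule Brouwer_degree2_eq) (simp add: nsphere_normalize_id in_topspace_nsphere_iff)
  also have "\<dots> = Brouwer_degree2 q (\<lambda>x. nsphere_normalize q (\<lambda>i. 1 * x i))"
    using Brouwer_degree2_homotopic [OF homotopy [of "-1"]]
      Brouwer_degree2_homotopic [OF homotopy [of 1]] by simp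
  also have "\<dots> = Brouwer_degree2 q id"
    by (rule Brouwer_degree2_eq) (simp add: nsphere_normalize_id)
  finally show ?thesis
    by (simp only: Brouwer_degree2_id)
qed

text \<open>Coordinate 0 is the m-th Chebyshev polynomial in \<open>x 0\<close>. The recursion makes
  sense on spheres of every dimension, which permits induction on \<open>q\<close>, although A_n
  only supplies the dimensions 2^n.\<close>

fun unit_power :: "nat \<Rightarrow> (nat \<Rightarrow> real) \<Rightarrow> nat \<Rightarrow> real" where
  "unit_power 0 x = cd_unit"
| "unit_power (Suc 0) x = x"
| "unit_power (Suc (Suc m)) x = (\<lambda>i. 2 * x 0 * unit_power (Suc m) x i - unit_power m x i)"

lemma unit_power_in_nsphere:
  assumes x: "x \<in> topspace (nsphere q)"
  shows "unit_power m x \<in> topspace (nsphere q)"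
proof -
  \<comment> \<open>The two-step recursion needs two consecutive norms together with the inner
    product of neighbours, which stays equal to \<open>x 0\<close>.\<close>
  have "(\<Sum>i\<le>q. (unit_power m x i)\<^sup>2) = 1 \<and> (\<Sum>i\<le>q. (unit_power (Suc m) x i)\<^sup>2) = 1 \<and>
        (\<Sum>i\<le>q. unit_power m x i * unit_power (Suc m) x i) = x 0"
  proof (induction m)
    case 0
    have "(\<Sum>i\<le>q. cd_unit i * x i) = x 0"
      by (simp add: cd_unit_def if_distrib [of "\<lambda>c. c * _"] cong: if_cong)
    then show ?case
      using x cd_unit_in_nsphere [of q] by (simp add: in_topspace_nsphere_iff)
  next
    case (Suc m)
    let ?a = "unit_power m x" and ?b = "unit_power (Suc m) x" and ?t = "x 0"
    have "(\<Sum>i\<le>q. (2 * ?t * ?b i - ?a i)\<^sup>2)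
        = 4 * ?t\<^sup>2 * (\<Sum>i\<le>q. (?b i)\<^sup>2) - 4 * ?t * (\<Sum>i\<le>q. ?a i * ?b i) + (\<Sum>i\<le>q. (?a i)\<^sup>2)"
      unfolding sum_distrib_left sum_subtractf [symmetric] sum.distrib [symmetric]
      by (rule sum.cong) (auto simp: power2_eq_square algebra_simps)
    moreover have "(\<Sum>i\<le>q. ?b i * (2 * ?t * ?b i - ?a i))
        = 2 * ?t * (\<Sum>i\<le>q. (?b i)\<^sup>2) - (\<Sum>i\<le>q. ?a i * ?b i)"
      unfolding sum_distrib_left sum_subtractf [symmetric]
      by (rule sum.cong) (auto simp: power2_eq_square algebra_simps)
    ultimately show ?case
      using Suc by (simp add: power2_eq_square)
  qed
  moreover have "\<forall>i>q. unit_power m x i = 0"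
    using x by (induction m x rule: unit_power.induct) (auto simp: in_topspace_nsphere_iff cd_unit_def)
  ultimately show ?thesis
    by (simp add: in_topspace_nsphere_iff)
qed

lemma continuous_map_unit_power: "continuous_map (nsphere q) (nsphere q) (unit_power m)"
proof -
  have "continuous_map (nsphere q) euclideanreal (\<lambda>x. unit_power m x i)" for i
  proof (induction m rule: unit_power.induct [where P = "\<lambda>m _. continuous_map (nsphere q) euclideanreal (\<lambda>x. unit_power m x i)"])
    case (3 m)
    then show ?case
      by (simp, intro continuous_intros continuous_map_nsphere_projection)
  qed (simp_all add: continuous_map_nsphere_projection)
  then show ?thesis
    by (simp add: continuous_map_nsphere_componentwise unit_power_in_nsphere)
qed

lemma unit_power_uminus: "unit_power m (\<lambda>i. - x i) i = (- 1) ^ m * unit_power m x i"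
  by (induction m x rule: unit_power.induct) (simp_all add: algebra_simps)

text \<open>The even-numbered terms of a Chebyshev sequence obey the same recursion with x_0
  replaced by 2 x_0^2 - 1, which is coordinate 0 of the square.\<close>

lemma unit_power_double: "unit_power (2 * m) x = unit_power m (unit_power 2 x)"
proof (induction m "unit_power 2 x" rule: unit_power.induct)
  case (3 m)
  have "unit_power 2 x 0 = 2 * (x 0)\<^sup>2 - 1"
    by (simp add: numeral_2_eq_2 cd_unit_def power2_eq_square)
  moreover have "unit_power (2 * Suc (Suc m)) x i
      = 2 * (2 * (x 0)\<^sup>2 - 1) * unit_power (2 * Suc m) x i - unit_power (2 * m) x i" for i
    by (simp add: algebra_simps power2_eq_square)
  ultimately show ?case
    using 3 by (intro ext) (simp del: mult_Suc_right)
qed simp_all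

text \<open>The 0-sphere consists of e_0 and -e_0, whose squares are e_0. This serves the base case
  of the degree parity below.\<close>

lemma unit_power_nsphere_0:
  assumes "x \<in> topspace (nsphere 0)"
  shows "unit_power (2 * m) x = cd_unit \<and> unit_power (Suc (2 * m)) x = x"
proof (induction m)
  case (Suc m)
  have "x 0 * x i = cd_unit i" "x 0 * cd_unit i = x i" for i
    using assms by (auto simp: in_topspace_nsphere_iff cd_unit_def power2_eq_square)
  with Suc show ?case
    by (simp add: mult.assoc)
qed simp

text \<open>Induction on the dimension: Borsuk's step makes the degrees of an odd map and of its
  restriction to the subsphere one dimension lower congruent mod 2, and that restriction is again
  the power map. On the 0-sphere it is the identity.\<close>

lemma odd_Brouwer_degree2_unit_power:
  assumes "odd m"
  shows "odd (Brouwer_degree2 q (unit_power m))"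
proof (induction q)
  case 0
  obtain j where "m = Suc (2 * j)" using \<open>odd m\<close> by (auto elim: oddE)
  then have "Brouwer_degree2 0 (unit_power m) = Brouwer_degree2 0 id"
    by (intro Brouwer_degree2_eq) (simp add: unit_power_nsphere_0 del: unit_power.simps)
  then show ?case by simp
next
  case (Suc q)
  have "even (Brouwer_degree2 (Suc q) (unit_power m) - Brouwer_degree2 (Suc q - Suc 0) (unit_power m))"
    by (rule Borsuk_odd_mapping_degree_step [OF continuous_map_unit_power])
       (use \<open>odd m\<close> in \<open>auto simp: unit_power_uminus unit_power_in_nsphere\<close>)
  with Suc show ?case by simp
qed

text \<open>The square is the reflection of \<open>e\<^sub>0\<close> in the hyperplane orthogonal to \<open>x\<close>, up to sign; it
  collapses the equator \<open>x\<^sub>0 = 0\<close> to \<open>-e\<^sub>0\<close> and wraps each open hemisphere once around the sphere.\<close>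

lemma Brouwer_degree2_unit_power_2:
  assumes "odd q"
  shows "Brouwer_degree2 q (unit_power 2) = 2"
proof -
  \<comment> \<open>Clamping \<open>x 0\<close> to one sign collapses the other hemisphere to -e_0,
    by a formula that is visibly continuous.\<close>
  define u where "u \<equiv> \<lambda>x i. 2 * max (x 0) 0 * x i - cd_unit i"
  define l where "l \<equiv> \<lambda>x i. 2 * min (x 0) 0 * x i - cd_unit i"
  have sq: "unit_power 2 x = (\<lambda>i. 2 * x 0 * x i - cd_unit i)" for x
    by (simp add: numeral_2_eq_2)
  have neg: "l x = u (\<lambda>i. - x i)" for x
    by (auto simp: u_def l_def max_def min_def)
  have u_cases: "u x = (if x 0 \<ge> 0 then unit_power 2 x else (\<lambda>i. - cd_unit i))" for x
    by (auto simp: u_def sq)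
  have u: "continuous_map (nsphere q) (nsphere q) u"
    unfolding continuous_map_nsphere_componentwise
  proof (intro conjI allI ballI)
    show "continuous_map (nsphere q) euclideanreal (\<lambda>x. u x i)" for i
      unfolding u_def by (intro continuous_intros continuous_map_nsphere_projection)
    show "u x \<in> topspace (nsphere q)" if "x \<in> topspace (nsphere q)" for x
      using unit_power_in_nsphere [OF that, of 2] cd_unit_in_nsphere [of q]
      by (simp add: u_cases in_topspace_nsphere_iff)
  qed
  have l_eq: "l = u \<circ> (\<lambda>x i. - x i)"
    by (simp add: neg fun_eq_iff)
  have l: "continuous_map (nsphere q) (nsphere q) l"
    unfolding l_eq by (rule continuous_map_compose [OF continuous_map_nsphere_uminus u])
  \<comment> \<open>If the segment from \<open>x\<close> to \<open>u x\<close> met 0, then c x = s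
    e_0 with c and s nonnegative. Norms give c = s > 0, hence x_0 = 1, but then c = 1 + s.\<close>
  have "homotopic_with (\<lambda>_. True) (nsphere q) (nsphere q) id u"
  proof (rule homotopic_with_nsphere_linear [OF continuous_map_id u], rule notI)
    fix x s
    assume x: "x \<in> topspace (nsphere q)" and s: "0 \<le> s" "s \<le> (1::real)"
      and *: "(\<lambda>i. (1 - s) * id x i + s * u x i) = (\<lambda>_. 0)"
    define c where "c = 1 - s + 2 * s * max (x 0) 0"
    have c: "c * x i = s * cd_unit i" for i
      using fun_cong [OF *, of i] by (simp add: c_def u_def algebra_simps)
    have "c\<^sup>2 * (\<Sum>i\<le>q. (x i)\<^sup>2) = s\<^sup>2 * (\<Sum>i\<le>q. (cd_unit i)\<^sup>2)"
      by (simp add: sum_distrib_left c flip: power_mult_distrib)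
    then have "c\<^sup>2 = s\<^sup>2"
      using x cd_unit_in_nsphere [of q] by (simp add: in_topspace_nsphere_iff)
    moreover have "c \<ge> 0" using s by (simp add: c_def)
    ultimately have "c = s" using s by simp
    moreover have "s \<noteq> 0" using \<open>c = s\<close> by (auto simp: c_def)
    ultimately have "x 0 = 1" using c [of 0] by (simp add: cd_unit_def)
    then show False using \<open>c = s\<close> s by (simp add: c_def)
  qed
  then have deg_u: "Brouwer_degree2 q u = 1"
    using Brouwer_degree2_homotopic by fastforce
  \<comment> \<open>The antipodal map has degree 1 because \<open>q\<close> is odd, so the two
    hemispheres add up instead of cancelling.\<close>
  have deg_l: "Brouwer_degree2 q l = 1"
    unfolding l_eq Brouwer_degree2_compose [OF continuous_map_nsphere_uminus u]
    by (simp add: deg_u Brouwer_degree2_uminus_odd \<open>odd q\<close>)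
  have "Brouwer_degree2 q (unit_power 2) = Brouwer_degree2 q u + Brouwer_degree2 q l"
    by (rule Brouwer_degree2_hemisphere_sum [OF _ continuous_map_unit_power u l, where c = "\<lambda>i. - cd_unit i"])
       (use \<open>odd q\<close> in \<open>auto simp: u_def l_def sq odd_pos\<close>)
  then show ?thesis by (simp add: deg_u deg_l)
qed

text \<open>An odd degree is nonzero, and halving an even exponent only splits off a factor
  2.\<close>

lemma Brouwer_degree2_unit_power_nonzero:
  assumes "odd q" "m > 0"
  shows "Brouwer_degree2 q (unit_power m) \<noteq> 0"
  using \<open>m > 0\<close>
proof (induction m rule: less_induct)
  case (less m)
  show ?case
  proof (cases "even m")
    case True
    then obtain j where j: "m = 2 * j" by blast
    have "Brouwer_degree2 q (unit_power m) = Brouwer_degree2 q (unit_power j \<circ> unit_power 2)"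
      by (rule Brouwer_degree2_eq) (simp add: j unit_power_double)
    also have "\<dots> = Brouwer_degree2 q (unit_power j) * 2"
      by (simp add: Brouwer_degree2_compose continuous_map_unit_power Brouwer_degree2_unit_power_2 \<open>odd q\<close>)
    finally show ?thesis
      using less j by simp
  next
    case False
    then show ?thesis
      using odd_Brouwer_degree2_unit_power [of m q] by auto
  qed
qed

subsection \<open>Cayley-Dickson algebras\<close>

lemma cd_components_in_cd_space:
  "cd_fst n x \<in> topspace (cd_space n)" "cd_snd n x \<in> topspace (cd_space n)"
  by (simp_all add: topspace_Euclidean_space cd_fst_def cd_snd_def)

lemma cd_pair_components:
  "x \<in> topspace (cd_space (Suc n)) \<Longrightarrow> cd_pair n (cd_fst n x) (cd_snd n x) = x"
  by (auto simp: topspace_Euclidean_space cd_pair_def cd_fst_def cd_snd_def fun_eq_iff)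

text \<open>Linearity is always stated for the one shape a u + b v; later terms such as
  \<open>(- 1) * x i\<close> or \<open>0 * ?u i\<close> are there to match it.\<close>

lemma cd_components_linear:
  "cd_fst n (\<lambda>i. a * u i + b * v i) = (\<lambda>i. a * cd_fst n u i + b * cd_fst n v i)"
  "cd_snd n (\<lambda>i. a * u i + b * v i) = (\<lambda>i. a * cd_snd n u i + b * cd_snd n v i)"
  by (auto simp: cd_fst_def cd_snd_def)

lemma cd_conj_linear:
  "cd_conj n (\<lambda>i. a * u i + b * v i) = (\<lambda>i. a * cd_conj n u i + b * cd_conj n v i)"
  by (induction n arbitrary: u v) (auto simp: cd_components_linear cd_pair_def)

text \<open>One induction for both sides, since the second component of the product reverses the
  factors.\<close>

lemma cd_mult_linear:
  shows cd_mult_linear_left: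
      "cd_mult n (\<lambda>i. a * u i + b * v i) w = (\<lambda>i. a * cd_mult n u w i + b * cd_mult n v w i)"
    and cd_mult_linear_right:
      "cd_mult n w (\<lambda>i. a * u i + b * v i) = (\<lambda>i. a * cd_mult n w u i + b * cd_mult n w v i)"
proof (induction n arbitrary: u v w)
  case 0
  { case 1 show ?case by (auto simp: algebra_simps) }
  { case 2 show ?case by (auto simp: algebra_simps) }
next
  case (Suc n)
  { case 1 show ?case
      by (simp add: Let_def cd_components_linear cd_conj_linear Suc) (auto simp: cd_pair_def algebra_simps) }
  { case 2 show ?case
      by (simp add: Let_def cd_components_linear cd_conj_linear Suc) (auto simp: cd_pair_def algebra_simps) }
qed

lemma cd_mult_zero: "cd_mult n (\<lambda>_. 0) v = (\<lambda>_. 0)" "cd_mult n v (\<lambda>_. 0) = (\<lambda>_. 0)"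
  using cd_mult_linear_left [of n 0 v 0 v v] cd_mult_linear_right [of n v 0 v 0 v] by simp_all

lemma cd_conj_zero: "cd_conj n (\<lambda>_. 0) = (\<lambda>_. 0)"
  using cd_conj_linear [of n 0 "\<lambda>_. 0" 0 "\<lambda>_. 0"] by simp

lemma cd_components_unit: "cd_fst n cd_unit = cd_unit" "cd_snd n cd_unit = (\<lambda>_. 0)"
  by (auto simp: cd_fst_def cd_snd_def cd_unit_def)

lemma cd_conj_eq:
  "x \<in> topspace (cd_space n) \<Longrightarrow> cd_conj n x = (\<lambda>i. 2 * x 0 * cd_unit i + (- 1) * x i)"
proof (induction n arbitrary: x)
  case 0
  then show ?case by (auto simp: topspace_Euclidean_space cd_unit_def fun_eq_iff)
next
  case (Suc n)
  have "cd_conj (Suc n) x = cd_pair n (\<lambda>i. 2 * cd_fst n x 0 * cd_unit i + (- 1) * cd_fst n x i) (\<lambda>i. - cd_snd n x i)"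
    by (simp add: Suc.IH cd_components_in_cd_space)
  also have "\<dots> = (\<lambda>i. 2 * x 0 * cd_unit i + (- 1) * x i)"
    using Suc.prems
    by (auto simp: topspace_Euclidean_space cd_pair_def cd_fst_def cd_snd_def cd_unit_def fun_eq_iff)
  finally show ?case .
qed

text \<open>Again a joint induction: left multiplication by e_0 produces \<open>y\<close> times e_0
  in the second component.\<close>

lemma cd_mult_unit:
  assumes "x \<in> topspace (cd_space n)"
  shows cd_mult_unit_left: "cd_mult n cd_unit x = x"
    and cd_mult_unit_right: "cd_mult n x cd_unit = x"
  using assms
proof (induction n arbitrary: x)
  case 0
  { case 1 then show ?case by (auto simp: topspace_Euclidean_space cd_unit_def fun_eq_iff) }
  { case 2 then show ?case by (auto simp: topspace_Euclidean_space cd_unit_def fun_eq_iff) }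
next
  case (Suc n)
  have conj: "cd_conj n cd_unit = cd_unit"
    by (subst cd_conj_eq) (auto simp: topspace_Euclidean_space cd_unit_def)
  { case 1 then show ?case
      by (simp add: Let_def cd_components_unit cd_mult_zero Suc.IH cd_components_in_cd_space cd_pair_components) }
  { case 2 then show ?case
      by (simp add: Let_def cd_components_unit cd_mult_zero conj cd_conj_zero Suc.IH
          cd_components_in_cd_space cd_pair_components) }
qed

text \<open>The quadratic relation of x. For x = (a, b), induction gives conj(b) b = |b|^2 e_0 and b
  conj(a) = 2 a_0 b - b a, so the mixed products cancel in the second component.\<close>

lemma cd_mult_self:
  "x \<in> topspace (cd_space n) \<Longrightarrow>
     cd_mult n x x = (\<lambda>i. 2 * x 0 * x i + (- (\<Sum>j<2 ^ n. (x j)\<^sup>2)) * cd_unit i)"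
proof (induction n arbitrary: x)
  case 0
  then show ?case
    by (auto simp: topspace_Euclidean_space cd_unit_def fun_eq_iff power2_eq_square)
next
  case (Suc n)
  define a b where "a = cd_fst n x" and "b = cd_snd n x"
  have ab: "a \<in> topspace (cd_space n)" "b \<in> topspace (cd_space n)"
    by (simp_all add: a_def b_def cd_components_in_cd_space)
  have split: "(\<Sum>j<k + m. f j) = (\<Sum>j<k. f j) + (\<Sum>j<m. f (j + k))" for f :: "nat \<Rightarrow> real" and k m
    by (induction m) (simp_all add: add.commute)
  have "(\<Sum>j<2 ^ Suc n. (x j)\<^sup>2) = (\<Sum>j<2 ^ n. (a j)\<^sup>2) + (\<Sum>j<2 ^ n. (b j)\<^sup>2)"
    using split [of "\<lambda>j. (x j)\<^sup>2" "2 ^ n" "2 ^ n"] by (simp add: a_def b_def cd_fst_def cd_snd_def mult_2)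
  moreover have "cd_mult (Suc n) x x = cd_pair n
      (\<lambda>i. 2 * a 0 * a i - ((\<Sum>j<2 ^ n. (a j)\<^sup>2) + (\<Sum>j<2 ^ n. (b j)\<^sup>2)) * cd_unit i) (\<lambda>i. 2 * a 0 * b i)"
  proof -
    have "cd_mult n (cd_conj n b) b = (\<lambda>i. (\<Sum>j<2 ^ n. (b j)\<^sup>2) * cd_unit i)"
      unfolding cd_conj_eq [OF ab(2)] cd_mult_linear_left cd_mult_unit_left [OF ab(2)] Suc.IH [OF ab(2)]
      by simp
    moreover have "cd_mult n b (cd_conj n a) = (\<lambda>i. 2 * a 0 * b i - cd_mult n b a i)"
      unfolding cd_conj_eq [OF ab(1)] cd_mult_linear_right cd_mult_unit_right [OF ab(2)]
      by simp
    ultimately show ?thesis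
      by (simp add: Let_def a_def [symmetric] b_def [symmetric] Suc.IH [OF ab(1)] algebra_simps)
  qed
  ultimately show ?case
    using Suc.prems
    by (auto simp: a_def b_def topspace_Euclidean_space cd_pair_def cd_fst_def cd_snd_def cd_unit_def fun_eq_iff)
qed

section \<open>Powers of scaled unit vectors\<close>

lemma cd_power_scale: "cd_power n (\<lambda>i. c * x i) m = (\<lambda>i. c ^ m * cd_power n x m i)"
proof (induction m)
  case (Suc m)
  then show ?case
    using cd_mult_linear_left [of n "c ^ m" "cd_power n x m" 0 "\<lambda>_. 0" "\<lambda>i. c * x i"]
      cd_mult_linear_right [of n "cd_power n x m" c x 0 "\<lambda>_. 0"]
    by (simp add: mult_ac)
qed simp

text \<open>By left linearity, multiplying a combination of x and e_0 by x only involves x x and e_0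
  x. So all powers stay in that span, and the quadratic relation yields the recursion without
  associativity.\<close>

lemma cd_power_unit_sphere:
  assumes n: "2 ^ n = Suc q" and x: "x \<in> topspace (nsphere q)"
  shows "cd_power n x m = unit_power m x"
proof -
  have xs: "x \<in> topspace (cd_space n)" and us: "cd_unit \<in> topspace (cd_space n)"
    and norm: "(\<Sum>j<2 ^ n. (x j)\<^sup>2) = 1"
    using x by (auto simp: topspace_Euclidean_space n in_topspace_nsphere_iff cd_unit_def lessThan_Suc_atMost)
  have sq: "cd_mult n x x = (\<lambda>i. 2 * x 0 * x i + (- 1) * cd_unit i)"
    using cd_mult_self [OF xs] by (simp add: norm)
  have ux: "cd_mult n cd_unit x = x" by (rule cd_mult_unit_left [OF xs])
  have span: "\<exists>a b. cd_power n x m = (\<lambda>i. a * x i + b * cd_unit i)" for m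
  proof (induction m)
    case 0
    show ?case by (intro exI [of _ 0] exI [of _ 1]) simp
  next
    case (Suc m)
    then obtain a b where "cd_power n x m = (\<lambda>i. a * x i + b * cd_unit i)" by blast
    then have "cd_power n x (Suc m) = (\<lambda>i. (2 * a * x 0 + b) * x i + (- a) * cd_unit i)"
      by (simp add: cd_mult_linear_left sq ux algebra_simps)
    then show ?case by blast
  qed
  have "cd_power n x m = unit_power m x \<and> cd_power n x (Suc m) = unit_power (Suc m) x"
  proof (induction m)
    case (Suc m)
    obtain a b where ab: "cd_power n x m = (\<lambda>i. a * x i + b * cd_unit i)"
      using span by blast
    then have ab': "cd_power n x (Suc m) = (\<lambda>i. (2 * a * x 0 + b) * x i + (- a) * cd_unit i)"
      by (simp add: cd_mult_linear_left sq ux algebra_simps)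
    have "cd_power n x (Suc (Suc m)) = cd_mult n (\<lambda>i. (2 * a * x 0 + b) * x i + (- a) * cd_unit i) x"
      using ab' by simp
    also have "\<dots> = (\<lambda>i. 2 * x 0 * cd_power n x (Suc m) i - cd_power n x m i)"
      unfolding ab ab' cd_mult_linear_left sq ux by (simp add: algebra_simps)
    finally show ?case
      using Suc by (simp only: unit_power.simps simp_thms)
  qed (simp add: ux)
  then show ?thesis ..
qed

section \<open>Coordinate bounds for products\<close>

lemma abs_cd_conj_le: "(\<And>i. \<bar>u i\<bar> \<le> A) \<Longrightarrow> \<bar>cd_conj n u i\<bar> \<le> A"
proof (induction n arbitrary: u i)
  case (Suc n)
  have "0 \<le> A" using Suc.prems [of 0] by linarith
  have "\<bar>cd_conj n (cd_fst n u) i\<bar> \<le> A" for i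
    by (rule Suc.IH) (use Suc.prems \<open>0 \<le> A\<close> in \<open>auto simp: cd_fst_def\<close>)
  then show ?case
    using Suc.prems \<open>0 \<le> A\<close> by (auto simp: cd_pair_def cd_snd_def)
qed simp

text \<open>The Euclidean norm is not multiplicative for n >= 4, so a crude coordinatewise bound is
  used: each doubling adds two products, whence the factor 2^n.\<close>

lemma abs_cd_mult_le:
  "\<lbrakk>\<And>i. \<bar>u i\<bar> \<le> A; \<And>i. \<bar>v i\<bar> \<le> B\<rbrakk> \<Longrightarrow> \<bar>cd_mult n u v i\<bar> \<le> 2 ^ n * (A * B)"
proof (induction n arbitrary: u v A B i)
  case 0
  have "0 \<le> A" "0 \<le> B" using "0.prems" [of 0] by linarith+
  then show ?case
    using mult_mono [OF "0.prems"(1) [of 0] "0.prems"(2) [of 0]] by (simp add: abs_mult)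
next
  case (Suc n)
  have "0 \<le> A" "0 \<le> B" using Suc.prems [of 0] by linarith+
  then have fst_snd: "\<bar>cd_fst n u i\<bar> \<le> A" "\<bar>cd_snd n u i\<bar> \<le> A" "\<bar>cd_fst n v i\<bar> \<le> B" "\<bar>cd_snd n v i\<bar> \<le> B" for i
    using Suc.prems by (simp_all add: cd_fst_def cd_snd_def)
  let ?a = "cd_fst n u" and ?b = "cd_snd n u" and ?x = "cd_fst n v" and ?y = "cd_snd n v"
  have mult: "\<bar>cd_mult n ?a ?x i\<bar> \<le> 2 ^ n * (A * B)" "\<bar>cd_mult n (cd_conj n ?y) ?b i\<bar> \<le> 2 ^ n * (B * A)"
    "\<bar>cd_mult n ?y ?a i\<bar> \<le> 2 ^ n * (B * A)" "\<bar>cd_mult n ?b (cd_conj n ?x) i\<bar> \<le> 2 ^ n * (A * B)" for i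
    by (intro Suc.IH abs_cd_conj_le fst_snd)+
  have "\<bar>cd_mult n ?a ?x i - cd_mult n (cd_conj n ?y) ?b i\<bar> \<le> 2 ^ Suc n * (A * B)"
    "\<bar>cd_mult n ?y ?a i + cd_mult n ?b (cd_conj n ?x) i\<bar> \<le> 2 ^ Suc n * (A * B)" for i
    using mult [of i] unfolding mult.commute [of B A] power_Suc mult.assoc [of 2] by linarith+
  then show ?case
    using \<open>0 \<le> A\<close> \<open>0 \<le> B\<close> by (simp add: Let_def cd_pair_def)
qed

lemma abs_le_cd_norm: "x \<in> topspace (cd_space n) \<Longrightarrow> \<bar>x i\<bar> \<le> cd_norm n x"
proof (cases "i < 2 ^ n")
  case True
  have "(\<bar>x i\<bar>)\<^sup>2 \<le> (\<Sum>j<2 ^ n. (x j)\<^sup>2)"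
    using True member_le_sum [of i "{..<2 ^ n}" "\<lambda>j. (x j)\<^sup>2"] by simp
  then show ?thesis
    unfolding cd_norm_def L2_set_def by (rule real_le_rsqrt)
next
  case False
  assume "x \<in> topspace (cd_space n)"
  with False show ?thesis
    by (simp add: topspace_Euclidean_space cd_norm_def L2_set_nonneg)
qed

subsection \<open>The fundamental theorem of algebra\<close>

theorem theorem3p4:
  fixes n k :: nat and p g :: "(nat \<Rightarrow> real) \<Rightarrow> (nat \<Rightarrow> real)"
  assumes "n \<ge> 1" and "k > 0"
    and "continuous_map (cd_space n) (cd_space n) p"
    and "continuous_map (subtopology (cd_space n) (- {\<lambda>_. 0})) (cd_space n) g"
    and "\<not> g constant_on (topspace (cd_space n) - {\<lambda>_. 0})"
    and "((\<lambda>x. cd_norm n (g x)) \<longlongrightarrow> 0)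
           ((cd_norm n) going_to at_top within (topspace (cd_space n) - {\<lambda>_. 0}))"
    and "\<And>x. x \<in> topspace (cd_space n) \<Longrightarrow> x \<noteq> (\<lambda>_. 0) \<Longrightarrow>
           p x = cd_mult n (cd_power n x k) (\<lambda>i. cd_unit i + g x i)"
  shows "\<exists>\<alpha>\<in>topspace (cd_space n). p \<alpha> = (\<lambda>_. 0)"
proof (rule ccontr)
  assume "\<not> ?thesis"
  then have nz: "p x \<noteq> (\<lambda>_. 0)" if "x \<in> topspace (cd_space n)" for x
    using that by blast
  \<comment> \<open>\<open>nsphere q\<close> is the unit sphere of A_n, and \<open>n \<ge> 1\<close>
    makes \<open>q\<close> odd.\<close>
  define q where "q = 2 ^ n - (1::nat)"
  have q: "2 ^ n = Suc q" by (simp add: q_def)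
  have "odd q" using \<open>n \<ge> 1\<close> by (simp add: q_def)
  have "\<forall>\<^sub>F x in (cd_norm n) going_to at_top within (topspace (cd_space n) - {\<lambda>_. 0}).
      cd_norm n (g x) < 1 / (2 ^ n * 2 ^ n)"
    using assms(6) by (rule order_tendstoD) simp
  \<comment> \<open>In the threshold, one factor 2^n offsets the constant of
    \<open>abs_cd_mult_le\<close>, the other the number of coordinates in the final sum.\<close>
  then obtain R0 where R0: "\<And>x. \<lbrakk>x \<in> topspace (cd_space n); x \<noteq> (\<lambda>_. 0); cd_norm n x \<ge> R0\<rbrakk>
      \<Longrightarrow> cd_norm n (g x) < 1 / (2 ^ n * 2 ^ n)"
    unfolding going_to_within_def eventually_inf_principal eventually_filtercomap eventually_at_top_linorder
    by blast
  define R where "R = max R0 1"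
  have R: "R \<ge> R0" "R > 0" by (simp_all add: R_def)
  let ?m = "\<lambda>x i. R * x i"
  have scale: "continuous_map (nsphere q) (cd_space n) ?m"
    by (simp add: q continuous_map_Euclidean_space_componentwise continuous_map_nsphere_projection
        continuous_map_real_mult_left in_topspace_nsphere_iff)
  have p: "continuous_map (cd_space n) (Euclidean_space (Suc q)) p"
    using assms(3) by (simp add: q)
  have p_scale: "continuous_map (nsphere q) (Euclidean_space (Suc q)) (\<lambda>x. p (?m x))"
    using continuous_map_compose [OF scale p] by (simp add: o_def)
  \<comment> \<open>The normalized map factors through the contractible A_n, because
    \<open>p\<close> has no zero there.\<close>
  obtain c where "homotopic_with (\<lambda>_. True) (nsphere q) (nsphere q)
      ((\<lambda>x. nsphere_normalize q (p x)) \<circ> ?m) (\<lambda>_. c)"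
    using nullhomotopic_through_contractible_space
      [OF scale continuous_map_nsphere_normalize [OF p nz] contractible_Euclidean_space] by blast
  then have "Brouwer_degree2 q (\<lambda>x. nsphere_normalize q (p (?m x))) = 0"
    using Brouwer_degree2_nullhomotopic unfolding o_def by blast
  moreover have "homotopic_with (\<lambda>_. True) (nsphere q) (nsphere q)
      (\<lambda>x. nsphere_normalize q (unit_power k x)) (\<lambda>x. nsphere_normalize q (p (?m x)))"
  proof (rule homotopic_with_nsphere_normalize [OF _ p_scale], goal_cases)
    case 1
    show ?case
      by (rule continuous_map_nsphere_imp_Euclidean_space [OF continuous_map_unit_power])
  next
    case (2 x s)
    let ?u = "unit_power k x"
    define w where "w = cd_mult n ?u (g (?m x))"
    have u: "?u \<in> topspace (nsphere q)" using 2(1) by (rule unit_power_in_nsphere)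
    then have us: "?u \<in> topspace (cd_space n)"
      by (simp add: q in_topspace_nsphere_iff topspace_Euclidean_space)
    have mx: "?m x \<in> topspace (cd_space n)"
      using 2 by (simp add: q in_topspace_nsphere_iff topspace_Euclidean_space)
    have norm: "cd_norm n (?m x) = R"
      using 2 R by (simp add: cd_norm_def L2_set_def q power_mult_distrib lessThan_Suc_atMost
          in_topspace_nsphere_iff flip: sum_distrib_left)
    have mx0: "?m x \<noteq> (\<lambda>_. 0)"
    proof
      assume "?m x = (\<lambda>_. 0)"
      then have "cd_norm n (?m x) = 0" by (simp add: cd_norm_def L2_set_def)
      then show False using norm R by simp
    qed
    have "g (?m x) \<in> topspace (cd_space n)"
      using continuous_map_image_subset_topspace [OF assms(4)] mx mx0 by auto
    then have g_small: "\<bar>g (?m x) i\<bar> \<le> cd_norm n (g (?m x))" for i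
      by (rule abs_le_cd_norm)
    have u1: "\<bar>?u i\<bar> \<le> 1" for i
      using topspace_nsphere_1 [OF u, of i] by (simp add: abs_square_le_1)
    have "cd_norm n (g (?m x)) < 1 / (2 ^ n * 2 ^ n)"
      using R0 [OF mx mx0] norm R by simp
    then have "2 ^ n * (1 * cd_norm n (g (?m x))) < 1 / 2 ^ n"
      by (simp add: field_simps)
    moreover have "\<bar>w i\<bar> \<le> 2 ^ n * (1 * cd_norm n (g (?m x)))" for i
      unfolding w_def by (rule abs_cd_mult_le [OF u1 g_small])
    ultimately have w_small: "\<bar>w i\<bar> < 1 / 2 ^ n" for i
      using le_less_trans by blast
    \<comment> \<open>Homogeneity extracts R^k from the power, and the product distributes over e_0
      + g; \<open>w\<close> is the error term.\<close>
    have pm: "p (?m x) i = R ^ k * (?u i + w i)" for i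
    proof -
      have "p (?m x) = cd_mult n (\<lambda>i. R ^ k * ?u i + 0 * ?u i) (\<lambda>i. 1 * cd_unit i + 1 * g (?m x) i)"
        using 2 by (simp add: assms(7) [OF mx mx0] cd_power_scale cd_power_unit_sphere [OF q])
      then show ?thesis
        unfolding cd_mult_linear by (simp add: cd_mult_unit_right [OF us] w_def)
    qed
    show ?case
    proof
      assume *: "(\<lambda>i. (1 - s) * ?u i + s * p (?m x) i) = (\<lambda>_. 0)"
      \<comment> \<open>A zero on the segment means (1 - s + s R^k) u = -s R^k w, so |u_i| <= |w_i|
        < 1 / 2^n. As u_i^2 <= |u_i|, the 2^n squares then sum to less than 1, contradicting that u
        is a unit vector.\<close>
      have "\<bar>?u i\<bar> < 1 / 2 ^ n" for i
      proof -
        let ?b = "s * R ^ k"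
        have b: "?b \<ge> 0" using 2 R by simp
        have b': "1 - s + ?b > 0"
        proof (cases "s = 1")
          case False
          then have "1 - s > 0" using 2 by simp
          then show ?thesis using b by linarith
        qed (use R in simp)
        have "(1 - s + ?b) * ?u i = - (?b * w i)"
          using fun_cong [OF *, of i] by (simp add: pm algebra_simps)
        then have "\<bar>(1 - s + ?b) * ?u i\<bar> = \<bar>?b * w i\<bar>" by simp
        then have "(1 - s + ?b) * \<bar>?u i\<bar> = ?b * \<bar>w i\<bar>"
          using b b' by (simp only: abs_mult [of ?b] abs_mult [of "1 - s + ?b"] abs_of_nonneg abs_of_pos)
        also have "\<dots> \<le> (1 - s + ?b) * \<bar>w i\<bar>"
          using 2 by (intro mult_right_mono) auto
        finally have "\<bar>?u i\<bar> \<le> \<bar>w i\<bar>" using b' by simp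
        then show ?thesis using w_small [of i] by simp
      qed
      moreover have "(?u i)\<^sup>2 \<le> \<bar>?u i\<bar>" for i
        using mult_left_le [OF u1 [of i] abs_ge_zero [of "?u i"]] by (simp add: power2_eq_square)
      ultimately have "(?u i)\<^sup>2 < 1 / 2 ^ n" for i
        using le_less_trans by blast
      then have "(\<Sum>i\<le>q. (?u i)\<^sup>2) < (\<Sum>i\<le>q. 1 / 2 ^ n)"
        by (intro sum_strict_mono) auto
      also have "\<dots> = 1" using arg_cong [OF q, of real] by simp
      finally show False using u by (simp add: in_topspace_nsphere_iff)
    qed
  qed
  then have "Brouwer_degree2 q (\<lambda>x. nsphere_normalize q (unit_power k x))
      = Brouwer_degree2 q (\<lambda>x. nsphere_normalize q (p (?m x)))"
    by (rule Brouwer_degree2_homotopic)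
  moreover have "Brouwer_degree2 q (\<lambda>x. nsphere_normalize q (unit_power k x)) = Brouwer_degree2 q (unit_power k)"
    by (rule Brouwer_degree2_eq) (simp add: nsphere_normalize_id unit_power_in_nsphere)
  ultimately show False
    using Brouwer_degree2_unit_power_nonzero [OF \<open>odd q\<close> \<open>k > 0\<close>] by simp
qed

end
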